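(* There are infinitely many finite sets of prime numbers that are MSTD sets.
   Context: For a finite set $S$ of integers, $S+S = \{x+y : x,y \in S\}$ and $S-S = \{x-y : x,y\in S\}$; $S$ is an MSTD (More Sums Than Differences) set if $|S+S| > |S-S|$. *)

theory Defs
  imports "HOL-Computational_Algebra.Primes"
begin

definition sumset :: "int set \<Rightarrow> int set" where
  "sumset S = {x + y | x y. x \<in> S \<and> y \<in> S}"

definition diffset :: "int set \<Rightarrow> int set" where
  "diffset S = {x - y | x y. x \<in> S \<and> y \<in> S}"

definition MSTD :: "int set \<Rightarrow> bool" where
  "MSTD S \<longleftrightarrow> finite S \<and> card (sumset S) > card (diffset S)"

end

theory Submission
  imports Defs
begin

text \<open>
  If a finite set \<open>A\<close> of positive integers satisfies \<open>|A + A| \<ge> |A - A| + |A|\<close>, then adjoining any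
  \<open>p > 2 max A\<close> yields an MSTD set: \<open>p\<close> contributes \<open>|A| + 1\<close> new sums and at most \<open>2 |A|\<close> new
  differences. Hence one such set consisting of primes produces one MSTD set of primes for every
  large prime.

  To find it, note that modulo \<open>12\<close> the sums of \<open>H = {0, 1, 2, 4, 5, 9}\<close> cover every class, whereas
  its differences miss the class of \<open>6\<close>. A set of primes \<open>17 + 6 k\<close> with \<open>k mod 12\<close> in \<open>H\<close> therefore
  tends to have more sums than differences by an amount proportional to its diameter, while a set
  with about the square root of that many elements already realises almost all admissible sums.
  The set of 96 such primes below was found by simulated annealing; it has 1282 sums and 1185
  differences.
\<close>

section \<open>Adjoining a large element\<close>

lemma finite_sumset:
  assumes "finite S"
  shows "finite (sumset S)"
proof -
  have "sumset S = (\<Union>x\<in>S. (+) x ` S)"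
    unfolding sumset_def by blast
  with assms show ?thesis by simp
qed

lemma MSTD_insert:
  assumes fin: "finite A" and ne: "A \<noteq> {}"
    and bounds: "\<And>a. a \<in> A \<Longrightarrow> 0 < a \<and> 2 * a < p"
    and surplus: "card (diffset A) + card A \<le> card (sumset A)"
  shows "MSTD (insert p A)"
proof -
  have fin_sum: "finite (sumset A)"
    using fin by (rule finite_sumset)
  have sum_less: "s < p" if s: "s \<in> sumset A" for s
  proof -
    obtain x y where "s = x + y" "x \<in> A" "y \<in> A"
      using s by (auto simp: sumset_def)
    with bounds[of x] bounds[of y] show ?thesis by linarith
  qed
  \<comment> \<open>Old sums lie below \<open>p\<close> and the sums \<open>p + a\<close> strictly
    between \<open>p\<close> and \<open>p + p\<close>, so nothing is counted twice.\<close>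
  have disj1: "sumset A \<inter> (+) p ` A = {}"
    using sum_less bounds by fastforce
  have disj2: "p + p \<notin> sumset A \<union> (+) p ` A"
  proof
    assume "p + p \<in> sumset A \<union> (+) p ` A"
    moreover obtain a where "a \<in> A" using ne by blast
    ultimately show False
      using sum_less bounds by fastforce
  qed
  have "insert (p + p) (sumset A \<union> (+) p ` A) \<subseteq> sumset (insert p A)"
    unfolding sumset_def by blast
  then have "card (insert (p + p) (sumset A \<union> (+) p ` A)) \<le> card (sumset (insert p A))"
    using fin by (intro card_mono finite_sumset) auto
  then have card_sum: "card (sumset A) + card A + 1 \<le> card (sumset (insert p A))"
    using disj1 disj2 fin fin_sum by (simp add: card_Un_disjoint card_image)
  \<comment> \<open>The remaining difference \<open>p - p = 0\<close> already lies in
    \<open>diffset A\<close>, as \<open>A\<close> is nonempty.\<close>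
  have diff_eq: "diffset (insert p A) = diffset A \<union> ((-) p ` A \<union> (\<lambda>a. a - p) ` A)"
    using ne by (auto simp: diffset_def)
  have "card (diffset (insert p A))
      \<le> card (diffset A) + (card ((-) p ` A) + card ((\<lambda>a. a - p) ` A))"
    unfolding diff_eq using card_Un_le[of "diffset A" "(-) p ` A \<union> (\<lambda>a. a - p) ` A"]
      card_Un_le[of "(-) p ` A" "(\<lambda>a. a - p) ` A"] by linarith
  also have "\<dots> \<le> card (diffset A) + (card A + card A)"
    using fin by (intro add_left_mono add_mono card_image_le)
  finally have "card (diffset (insert p A)) \<le> card (diffset A) + (card A + card A)" .
  with card_sum surplus have "card (diffset (insert p A)) < card (sumset (insert p A))"
    by linarith
  with fin show ?thesis
    by (simp add: MSTD_def)
qed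

section \<open>Counting sums and differences with indicator lists\<close>

definition positions :: "bool list \<Rightarrow> nat set" where
  "positions bs = {i. i < length bs \<and> bs ! i}"

fun list_or :: "bool list \<Rightarrow> bool list \<Rightarrow> bool list" where
  "list_or [] bs = bs"
| "list_or as [] = as"
| "list_or (a # as) (b # bs) = (a \<or> b) # list_or as bs"

text \<open>Horner scheme for multiplying polynomials over the Boolean semiring, with
  \<open>list_or\<close> as addition; it makes sets of sums computable.\<close>

fun convolve :: "bool list \<Rightarrow> bool list \<Rightarrow> bool list" where
  "convolve [] cs = []"
| "convolve (b # bs) cs =
     (if b then list_or cs (False # convolve bs cs) else False # convolve bs cs)"

text \<open>Position 0 stands for the integer \<open>i\<close>. The encoding is faithful for
  strictly increasing entries that are at least \<open>i\<close>; otherwise \<open>nat\<close> cuts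
  a negative gap to 0.\<close>

fun indicator_list :: "int \<Rightarrow> int list \<Rightarrow> bool list" where
  "indicator_list i [] = []"
| "indicator_list i (k # ks) =
     replicate (nat (k - i)) False @ True # indicator_list (k + 1) ks"

abbreviation count_true :: "bool list \<Rightarrow> nat" where
  "count_true bs \<equiv> length (filter (\<lambda>b. b) bs)"

lemma card_positions: "card (positions bs) = count_true bs"
  by (simp add: positions_def length_filter_conv_card)

lemma positions_Nil: "positions [] = {}"
  by (simp add: positions_def)

lemma positions_Cons: "positions (b # bs) = (if b then {0} else {}) \<union> Suc ` positions bs"
proof (intro set_eqI)
  fix i show "i \<in> positions (b # bs) \<longleftrightarrow> i \<in> (if b then {0} else {}) \<union> Suc ` positions bs"
    by (cases i) (auto simp: positions_def)
qed

lemma positions_list_or: "positions (list_or as bs) = positions as \<union> positions bs"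
  by (induction as bs rule: list_or.induct) (auto simp: positions_Nil positions_Cons image_Un)

lemma positions_convolve:
  "positions (convolve bs cs) = (\<Union>i\<in>positions bs. (+) i ` positions cs)"
proof (induction bs)
  case Nil
  show ?case by (simp add: positions_Nil)
next
  case (Cons b bs)
  then show ?case
    by (simp add: positions_Cons positions_list_or image_UN image_image)
qed

lemma positions_rev: "positions (rev bs) = (\<lambda>i. length bs - Suc i) ` positions bs"
proof (intro equalityI subsetI)
  fix i assume "i \<in> positions (rev bs)"
  then have "i < length bs" "bs ! (length bs - Suc i)"
    by (auto simp: positions_def rev_nth)
  then show "i \<in> (\<lambda>i. length bs - Suc i) ` positions bs"
    by (intro image_eqI[of _ _ "length bs - Suc i"]) (auto simp: positions_def)
qed (auto simp: positions_def rev_nth)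

lemma positions_append_replicate_False:
  "positions (replicate n False @ bs) = (+) n ` positions bs"
  by (induction n) (simp_all add: positions_Cons image_image)

lemma positions_indicator_list:
  assumes "sorted_wrt (<) ks" and "\<And>k. k \<in> set ks \<Longrightarrow> i \<le> k"
  shows "(\<lambda>j. i + int j) ` positions (indicator_list i ks) = set ks"
  using assms
proof (induction ks arbitrary: i)
  case Nil
  show ?case by (simp add: positions_Nil)
next
  case (Cons k ks)
  have "(\<lambda>j. (k + 1) + int j) ` positions (indicator_list (k + 1) ks) = set ks"
    using Cons.prems by (intro Cons.IH) auto
  moreover have "i \<le> k"
    using Cons.prems by simp
  ultimately show ?case
    by (simp add: positions_append_replicate_False positions_Cons image_image ac_simps)
qed

text \<open>A sum of two elements depends only on the sum \<open>m\<close> of their positions,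
  injectively through \<open>2 * a + q * m\<close>.\<close>

lemma card_sumset_affine_positions:
  assumes "q \<noteq> 0"
  shows "card (sumset ((\<lambda>i. a + q * int i) ` positions bs)) = count_true (convolve bs bs)"
proof -
  have "sumset ((\<lambda>i. a + q * int i) ` positions bs)
      = (\<Union>i\<in>positions bs. (\<lambda>j. a + q * int i + (a + q * int j)) ` positions bs)"
    unfolding sumset_def by blast
  also have "\<dots> = (\<lambda>m. 2 * a + q * int m) ` positions (convolve bs bs)"
    by (simp add: positions_convolve image_UN image_image algebra_simps)
  finally have "sumset ((\<lambda>i. a + q * int i) ` positions bs)
      = (\<lambda>m. 2 * a + q * int m) ` positions (convolve bs bs)" .
  moreover have "inj (\<lambda>m. 2 * a + q * int m)"
    using assms by (auto intro: injI)
  ultimately show ?thesis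
    by (metis card_image card_positions inj_on_subset subset_UNIV)
qed

text \<open>Up to a translation, \<open>A - A\<close> is the sum of \<open>A\<close> and its reflection.\<close>

lemma card_diffset_affine_positions:
  assumes "q \<noteq> 0"
  shows "card (diffset ((\<lambda>i. a + q * int i) ` positions bs)) = count_true (convolve bs (rev bs))"
proof -
  \<comment> \<open>Position \<open>m = i + (length bs - Suc j)\<close> encodes the difference
    \<open>i - j\<close>, so \<open>f\<close> undoes a shift by
    \<open>length bs - 1\<close>.\<close>
  define f where "f m = q * (int m - (int (length bs) - 1))" for m
  have f_eq: "a + q * int i - (a + q * int j) = f (i + (length bs - Suc j))"
    if "j \<in> positions bs" for i j
    using that by (simp add: positions_def f_def algebra_simps)
  have "diffset ((\<lambda>i. a + q * int i) ` positions bs)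
      = (\<Union>i\<in>positions bs. (\<lambda>j. a + q * int i - (a + q * int j)) ` positions bs)"
    unfolding diffset_def by blast
  also have "\<dots> = (\<Union>i\<in>positions bs. (\<lambda>j. f (i + (length bs - Suc j))) ` positions bs)"
    by (intro SUP_cong image_cong refl f_eq)
  also have "\<dots> = f ` positions (convolve bs (rev bs))"
    by (simp add: positions_convolve positions_rev image_UN image_image)
  finally have "diffset ((\<lambda>i. a + q * int i) ` positions bs)
      = f ` positions (convolve bs (rev bs))" .
  moreover have "inj f"
    using assms by (auto intro: injI simp: f_def)
  ultimately show ?thesis
    by (metis card_image card_positions inj_on_subset subset_UNIV)
qed

section \<open>A set of primes with a large surplus of sums\<close>

text \<open>Trial division: in \<open>p = d * e\<close> both proper factors would be at least
  \<open>n\<close>, giving \<open>p \<ge> n * n\<close>. The condition \<open>d < p\<close> admits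
  primes below \<open>n\<close> as well.\<close>

lemma prime_int_if_no_small_divisor:
  fixes p n :: int
  assumes "1 < p" and "0 \<le> n" and "p < n\<^sup>2"
    and no_div: "\<And>d. 2 \<le> d \<Longrightarrow> d < n \<Longrightarrow> d < p \<Longrightarrow> \<not> d dvd p"
  shows "prime p"
proof (rule ccontr)
  assume "\<not> prime p"
  then obtain d where d: "2 \<le> d" "d < p" "d dvd p"
    using \<open>1 < p\<close> by (auto simp: prime_int_iff')
  then obtain e where e: "p = d * e"
    by (elim dvdE)
  have "0 < e"
    using d e \<open>1 < p\<close> zero_less_mult_pos[of d e] by simp
  moreover have "e \<noteq> 1"
    using d e by auto
  moreover from this have "e < p"
    using d e by simp
  ultimately have "n \<le> d" "n \<le> e"
    using no_div[of d] no_div[of e] d e by force+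
  then have "n * n \<le> d * e"
    using \<open>0 \<le> n\<close> d by (intro mult_mono) auto
  then show False
    using \<open>p < n\<^sup>2\<close> e by (simp add: power2_eq_square)
qed

definition offsets :: "int list" where
  "offsets =
    [0, 1, 2, 4, 9, 12, 14, 16, 25, 26, 36, 40, 41, 49, 50, 62, 64, 69, 74, 77, 81, 84,
     96, 97, 100, 117, 124, 132, 137, 156, 160, 161, 169, 180, 181, 196, 201, 217, 232,
     237, 244, 245, 249, 256, 257, 261, 301, 305, 309, 337, 345, 349, 365, 389, 401,
     421, 429, 432, 441, 445, 456, 477, 480, 485, 492, 497, 501, 517, 520, 529, 532,
     540, 552, 557, 565, 585, 590, 600, 601, 609, 614, 617, 624, 625, 636, 641, 649,
     650, 652, 662, 664, 665, 672, 676, 677, 686]"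

definition base_primes :: "int set" where
  "base_primes = (\<lambda>k. 17 + 6 * k) ` set offsets"

lemma offsets_bounds: "list_all (\<lambda>k. 0 \<le> k \<and> k \<le> 686) offsets"
  unfolding offsets_def by simp

lemma base_primes_bounds:
  assumes "p \<in> base_primes"
  shows "1 < p \<and> p \<le> 4133"
  using assms offsets_bounds by (auto simp: base_primes_def list_all_iff)

lemma prime_base_primes:
  assumes "p \<in> base_primes"
  shows "prime p"
proof -
  \<comment> \<open>Divisors up to 66 suffice because 4133 < 67 * 67 = 4489.\<close>
  have "list_all (\<lambda>k. list_all (\<lambda>d. (17 + 6 * k) mod d = 0 \<longrightarrow> 17 + 6 * k \<le> d) [2..66]) offsets"
    by code_simp
  then have "\<forall>k\<in>set offsets. \<forall>d\<in>{2..66}. d dvd 17 + 6 * k \<longrightarrow> 17 + 6 * k \<le> d"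
    unfolding list_all_iff set_upto dvd_eq_mod_eq_0 .
  with assms have "\<not> d dvd p" if "2 \<le> d" "d < 67" "d < p" for d
    using that by (force simp: base_primes_def)
  moreover have "1 < p" "0 \<le> (67 :: int)" "p < 67\<^sup>2"
    using base_primes_bounds[OF assms] by auto
  ultimately show ?thesis
    by (intro prime_int_if_no_small_divisor)
qed

lemma base_primes_eq_positions:
  "base_primes = (\<lambda>i. 17 + 6 * int i) ` positions (indicator_list 0 offsets)"
proof -
  have "sorted_wrt (<) offsets"
    by (simp add: offsets_def sorted_wrt2_simps del: sorted_wrt.simps)
  then have "(\<lambda>j. 0 + int j) ` positions (indicator_list 0 offsets) = set offsets"
    using offsets_bounds by (intro positions_indicator_list) (auto simp: list_all_iff)
  then show ?thesis
    unfolding base_primes_def by (metis (no_types, lifting) add_0 image_cong image_image)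
qed

lemma card_sumset_diffset_base_primes:
  "card (sumset base_primes) = 1282 \<and> card (diffset base_primes) = 1185"
proof -
  have "(let bs = indicator_list 0 offsets
         in count_true (convolve bs bs) = 1282 \<and> count_true (convolve bs (rev bs)) = 1185)"
    by code_simp
  then show ?thesis
    by (simp add: base_primes_eq_positions card_sumset_affine_positions
          card_diffset_affine_positions Let_def)
qed

text \<open>An upper bound is enough: the surplus condition becomes 1185 + 96 <= 1282.\<close>

lemma card_base_primes: "card base_primes \<le> 96"
proof -
  have "card base_primes \<le> length offsets"
    unfolding base_primes_def by (metis card_image_le card_length finite_set le_trans)
  also have "length offsets = 96"
    by (simp add: offsets_def)
  finally show ?thesis .
qed

text \<open>The threshold 8266 is twice 4133, the largest base prime.\<close>

lemma MSTD_insert_base_primes: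
  assumes "p > 8266"
  shows "MSTD (insert p base_primes)"
proof (rule MSTD_insert)
  show "finite base_primes"
    by (simp add: base_primes_def)
  show "base_primes \<noteq> {}"
    by (simp add: base_primes_def offsets_def)
  show "0 < a \<and> 2 * a < p" if "a \<in> base_primes" for a
    using base_primes_bounds[OF that] assms by linarith
  show "card (diffset base_primes) + card base_primes \<le> card (sumset base_primes)"
    using card_sumset_diffset_base_primes card_base_primes by linarith
qed

theorem theorem1p4:
  shows "infinite {S :: int set. finite S \<and> (\<forall>p\<in>S. prime p) \<and> MSTD S}"
proof -
  define Q where "Q = {q :: nat. prime q \<and> q > 8266}"
  have "Q = {q. prime q} - {..8266}"
    by (auto simp: Q_def)
  then have "infinite Q"
    using primes_infinite by simp
  moreover have "inj_on (\<lambda>q. insert (int q) base_primes) Q"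
  proof (rule inj_onI)
    \<comment> \<open>The adjoined prime exceeds all base primes, so the set determines it.\<close>
    fix q r assume "q \<in> Q" "r \<in> Q" and eq: "insert (int q) base_primes = insert (int r) base_primes"
    then have "int q \<notin> base_primes"
      using base_primes_bounds[of "int q"] by (auto simp: Q_def)
    with eq show "q = r" by (metis insertE insertI1 of_nat_eq_iff)
  qed
  ultimately have "infinite ((\<lambda>q. insert (int q) base_primes) ` Q)"
    using finite_imageD by blast
  moreover have "(\<lambda>q. insert (int q) base_primes) ` Q
      \<subseteq> {S. finite S \<and> (\<forall>p\<in>S. prime p) \<and> MSTD S}"
    using prime_base_primes MSTD_insert_base_primes by (auto simp: Q_def base_primes_def)
  ultimately show ?thesis
    using finite_subset by blast
qed

end
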